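(* Let $G$ be a directed graph on $n$ vertices with positive real capacities $w$, a designated source vertex $s$ and a designated sink vertex $t$, and let $f$ be a maximum $(s,t)$-flow in $G$. Let $H$ be any subgraph of $G$ whose underlying undirected graph is a cycle and such that every edge $e$ of $H$ satisfies $0<f(e)<w(e)$. Then some edge of $H$ is a non-loose edge of $G$, and there is an algorithm that computes such a non-loose edge in $\mathcal{O}(n)$ time.
   Context: An $(s,t)$-cut is a set $C\subset V$ with $s\in C$, $t\notin C$; its capacity is the total capacity of edges from $C$ to $V\setminus C$. An edge is vital if its removal strictly decreases the minimum $(s,t)$-cut capacity. A vital edge $e$ is tight if some maximum $(s,t)$-flow $g$ has $g(e)=w(e)$, and loose otherwise. An edge is non-loose if it is either tight or not vital. *)

theory Defs
  imports "Graph_Theory.Graph_Theory" "HOL-Library.Landau_Symbols"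
begin

section \<open>Networks, flows and cuts\<close>

text \<open>
  Parallel arcs and loops are admitted; digraphs whose arcs are pairs of distinct vertices are a
  special case.
\<close>

locale st_network = fin_digraph G
  for G :: "('v, 'e) pre_digraph" and w :: "'e \<Rightarrow> real" and s t :: 'v +
  assumes source_in_verts: "s \<in> verts G"
    and sink_in_verts: "t \<in> verts G"
    and source_neq_sink: "s \<noteq> t"
    and cap_pos: "e \<in> arcs G \<Longrightarrow> 0 < w e"

definition st_cut :: "('v, 'e) pre_digraph \<Rightarrow> 'v \<Rightarrow> 'v \<Rightarrow> 'v set \<Rightarrow> bool" where
  "st_cut G s t C \<longleftrightarrow> C \<subseteq> verts G \<and> s \<in> C \<and> t \<notin> C"

definition cut_cap :: "('v, 'e) pre_digraph \<Rightarrow> ('e \<Rightarrow> real) \<Rightarrow> 'v set \<Rightarrow> real" where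
  "cut_cap G w C = (\<Sum>e | e \<in> arcs G \<and> tail G e \<in> C \<and> head G e \<in> verts G - C. w e)"

definition min_cut_cap :: "('v, 'e) pre_digraph \<Rightarrow> ('e \<Rightarrow> real) \<Rightarrow> 'v \<Rightarrow> 'v \<Rightarrow> real" where
  "min_cut_cap G w s t = Min (cut_cap G w ` {C. st_cut G s t C})"

definition net_outflow :: "('v, 'e) pre_digraph \<Rightarrow> ('e \<Rightarrow> real) \<Rightarrow> 'v \<Rightarrow> real" where
  "net_outflow G g v = (\<Sum>e \<in> out_arcs G v. g e) - (\<Sum>e \<in> in_arcs G v. g e)"

definition st_flow ::
    "('v, 'e) pre_digraph \<Rightarrow> ('e \<Rightarrow> real) \<Rightarrow> 'v \<Rightarrow> 'v \<Rightarrow> ('e \<Rightarrow> real) \<Rightarrow> bool" where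
  "st_flow G w s t g \<longleftrightarrow>
     (\<forall>e \<in> arcs G. 0 \<le> g e \<and> g e \<le> w e) \<and>
     (\<forall>v \<in> verts G - {s, t}. net_outflow G g v = 0)"

definition max_flow ::
    "('v, 'e) pre_digraph \<Rightarrow> ('e \<Rightarrow> real) \<Rightarrow> 'v \<Rightarrow> 'v \<Rightarrow> ('e \<Rightarrow> real) \<Rightarrow> bool" where
  "max_flow G w s t g \<longleftrightarrow>
     st_flow G w s t g \<and>
     (\<forall>g'. st_flow G w s t g' \<longrightarrow> net_outflow G g' s \<le> net_outflow G g s)"

definition vital :: "('v, 'e) pre_digraph \<Rightarrow> ('e \<Rightarrow> real) \<Rightarrow> 'v \<Rightarrow> 'v \<Rightarrow> 'e \<Rightarrow> bool" where
  "vital G w s t e \<longleftrightarrow>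
     e \<in> arcs G \<and> min_cut_cap (pre_digraph.del_arc G e) w s t < min_cut_cap G w s t"

definition tight :: "('v, 'e) pre_digraph \<Rightarrow> ('e \<Rightarrow> real) \<Rightarrow> 'v \<Rightarrow> 'v \<Rightarrow> 'e \<Rightarrow> bool" where
  "tight G w s t e \<longleftrightarrow> vital G w s t e \<and> (\<exists>g. max_flow G w s t g \<and> g e = w e)"

definition non_loose :: "('v, 'e) pre_digraph \<Rightarrow> ('e \<Rightarrow> real) \<Rightarrow> 'v \<Rightarrow> 'v \<Rightarrow> 'e \<Rightarrow> bool" where
  "non_loose G w s t e \<longleftrightarrow> e \<in> arcs G \<and> (tight G w s t e \<or> \<not> vital G w s t e)"

text \<open>
  The underlying undirected graph is read as a multigraph: a loop is a cycle of length 1, and two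
  parallel or antiparallel arcs form a cycle of length 2.
\<close>

definition underlying_cycle :: "('v, 'e) pre_digraph \<Rightarrow> bool" where
  "underlying_cycle H \<longleftrightarrow>
     (\<exists>us cs. us \<noteq> [] \<and> length cs = length us \<and>
        distinct us \<and> set us = verts H \<and> distinct cs \<and> set cs = arcs H \<and>
        (\<forall>i < length us.
           {tail H (cs ! i), head H (cs ! i)} = {us ! i, us ! (Suc i mod length us)}))"

definition slack_cycle ::
    "('v, 'e) pre_digraph \<Rightarrow> ('e \<Rightarrow> real) \<Rightarrow> ('e \<Rightarrow> real) \<Rightarrow> ('v, 'e) pre_digraph \<Rightarrow> bool" where
  "slack_cycle G w f H \<longleftrightarrow>
     subgraph H G \<and> underlying_cycle H \<and> (\<forall>e \<in> arcs H. 0 < f e \<and> f e < w e)"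


section \<open>A uniform-cost random access machine over the reals\<close>

text \<open>
  Memory consists of named arrays of natural numbers and named arrays of reals; a scalar is cell 0
  of its array. Reals can only be copied, added, subtracted and compared, and cannot be used as
  indices. Every node of an evaluated expression and every executed command costs one time unit.
\<close>

record mem =
  nats :: "string \<Rightarrow> nat \<Rightarrow> nat"
  reals :: "string \<Rightarrow> nat \<Rightarrow> real"

datatype nexp =
    NConst nat
  | NGet string nexp
  | NAdd nexp nexp
  | NSub nexp nexp

datatype rexp =
    RGet string nexp
  | RAdd rexp rexp
  | RSub rexp rexp

datatype bexp =
    NLess nexp nexp
  | RLess rexp rexp
  | Not bexp
  | And bexp bexp

datatype com =
    Skip
  | NSet string nexp nexp
  | RSet string nexp rexp
  | Seq com com
  | If bexp com com
  | While bexp com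

primrec nval :: "nexp \<Rightarrow> mem \<Rightarrow> nat" where
  "nval (NConst c) \<sigma> = c"
| "nval (NGet x i) \<sigma> = nats \<sigma> x (nval i \<sigma>)"
| "nval (NAdd a b) \<sigma> = nval a \<sigma> + nval b \<sigma>"
| "nval (NSub a b) \<sigma> = nval a \<sigma> - nval b \<sigma>"

primrec rval :: "rexp \<Rightarrow> mem \<Rightarrow> real" where
  "rval (RGet x i) \<sigma> = reals \<sigma> x (nval i \<sigma>)"
| "rval (RAdd a b) \<sigma> = rval a \<sigma> + rval b \<sigma>"
| "rval (RSub a b) \<sigma> = rval a \<sigma> - rval b \<sigma>"

primrec bval :: "bexp \<Rightarrow> mem \<Rightarrow> bool" where
  "bval (NLess a b) \<sigma> \<longleftrightarrow> nval a \<sigma> < nval b \<sigma>"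
| "bval (RLess a b) \<sigma> \<longleftrightarrow> rval a \<sigma> < rval b \<sigma>"
| "bval (Not b) \<sigma> \<longleftrightarrow> \<not> bval b \<sigma>"
| "bval (And b c) \<sigma> \<longleftrightarrow> bval b \<sigma> \<and> bval c \<sigma>"

primrec ncost :: "nexp \<Rightarrow> nat" where
  "ncost (NConst c) = 1"
| "ncost (NGet x i) = 1 + ncost i"
| "ncost (NAdd a b) = 1 + ncost a + ncost b"
| "ncost (NSub a b) = 1 + ncost a + ncost b"

primrec rcost :: "rexp \<Rightarrow> nat" where
  "rcost (RGet x i) = 1 + ncost i"
| "rcost (RAdd a b) = 1 + rcost a + rcost b"
| "rcost (RSub a b) = 1 + rcost a + rcost b"

primrec bcost :: "bexp \<Rightarrow> nat" where
  "bcost (NLess a b) = 1 + ncost a + ncost b"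
| "bcost (RLess a b) = 1 + rcost a + rcost b"
| "bcost (Not b) = 1 + bcost b"
| "bcost (And b c) = 1 + bcost b + bcost c"

definition nset :: "string \<Rightarrow> nat \<Rightarrow> nat \<Rightarrow> mem \<Rightarrow> mem" where
  "nset x i c \<sigma> = \<sigma>\<lparr>nats := (nats \<sigma>)(x := (nats \<sigma> x)(i := c))\<rparr>"

definition rset :: "string \<Rightarrow> nat \<Rightarrow> real \<Rightarrow> mem \<Rightarrow> mem" where
  "rset x i c \<sigma> = \<sigma>\<lparr>reals := (reals \<sigma>)(x := (reals \<sigma> x)(i := c))\<rparr>"

text \<open>\<open>exec P \<sigma> k \<sigma>'\<close>: started in \<open>\<sigma>\<close>, the program \<open>P\<close> halts in \<open>\<sigma>'\<close> after exactly \<open>k\<close> time units.\<close>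

inductive exec :: "com \<Rightarrow> mem \<Rightarrow> nat \<Rightarrow> mem \<Rightarrow> bool" where
  exec_Skip: "exec Skip \<sigma> 1 \<sigma>"
| exec_NSet: "exec (NSet x i a) \<sigma> (1 + ncost i + ncost a) (nset x (nval i \<sigma>) (nval a \<sigma>) \<sigma>)"
| exec_RSet: "exec (RSet x i a) \<sigma> (1 + ncost i + rcost a) (rset x (nval i \<sigma>) (rval a \<sigma>) \<sigma>)"
| exec_Seq: "exec P \<sigma> k \<sigma>' \<Longrightarrow> exec Q \<sigma>' l \<sigma>'' \<Longrightarrow> exec (Seq P Q) \<sigma> (1 + k + l) \<sigma>''"
| exec_If_True: "bval b \<sigma> \<Longrightarrow> exec P \<sigma> k \<sigma>' \<Longrightarrow> exec (If b P Q) \<sigma> (1 + bcost b + k) \<sigma>'"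
| exec_If_False: "\<not> bval b \<sigma> \<Longrightarrow> exec Q \<sigma> k \<sigma>' \<Longrightarrow> exec (If b P Q) \<sigma> (1 + bcost b + k) \<sigma>'"
| exec_While_False: "\<not> bval b \<sigma> \<Longrightarrow> exec (While b P) \<sigma> (1 + bcost b) \<sigma>"
| exec_While_True:
    "bval b \<sigma> \<Longrightarrow> exec P \<sigma> k \<sigma>' \<Longrightarrow> exec (While b P) \<sigma>' l \<sigma>'' \<Longrightarrow>
     exec (While b P) \<sigma> (1 + bcost b + k + l) \<sigma>''"


section \<open>The input of the algorithm\<close>

definition numbers :: "'a list \<Rightarrow> nat \<Rightarrow> 'a \<Rightarrow> bool" where
  "numbers xs i x \<longleftrightarrow> i < length xs \<and> xs ! i = x"

text \<open>
  The lists \<open>vs\<close> and \<open>es\<close> number the vertices and arcs of \<open>G\<close> arbitrarily, and \<open>hs\<close> lists the arcs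
  of \<open>H\<close> in arbitrary order, not necessarily in the order in which they occur on the cycle. All
  cells not mentioned may hold arbitrary values.
\<close>

definition input_mem ::
    "('v, 'e) pre_digraph \<Rightarrow> ('e \<Rightarrow> real) \<Rightarrow> 'v \<Rightarrow> 'v \<Rightarrow> ('e \<Rightarrow> real) \<Rightarrow>
     ('v, 'e) pre_digraph \<Rightarrow> 'v list \<Rightarrow> 'e list \<Rightarrow> 'e list \<Rightarrow> mem \<Rightarrow> bool" where
  "input_mem G w s t f H vs es hs \<sigma> \<longleftrightarrow>
     distinct vs \<and> set vs = verts G \<and>
     distinct es \<and> set es = arcs G \<and>
     distinct hs \<and> set hs = arcs H \<and>
     nats \<sigma> ''n'' 0 = length vs \<and>
     nats \<sigma> ''m'' 0 = length es \<and>
     nats \<sigma> ''k'' 0 = length hs \<and>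
     numbers vs (nats \<sigma> ''s'' 0) s \<and>
     numbers vs (nats \<sigma> ''t'' 0) t \<and>
     (\<forall>j < length es.
        numbers vs (nats \<sigma> ''tail'' j) (tail G (es ! j)) \<and>
        numbers vs (nats \<sigma> ''head'' j) (head G (es ! j)) \<and>
        reals \<sigma> ''w'' j = w (es ! j) \<and>
        reals \<sigma> ''f'' j = f (es ! j)) \<and>
     (\<forall>i < length hs. numbers es (nats \<sigma> ''H'' i) (hs ! i))"

end

theory Submission
  imports Defs
begin

text \<open>
  Orient the cycle and push along it the least residual capacity \<open>w e - f e\<close> of a forward arc,
  respectively \<open>f e\<close> of a backward arc. Net outflows do not change, so the result is again a maximum
  flow, and the arc attaining the minimum is now saturated or carries no flow. A saturated arc is
  tight or not vital. An arc carrying no flow is not vital: the flow survives its deletion, so by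
  weak duality the minimum cut capacity does not drop. Finding this arc only takes a traversal of
  the cycle.
\<close>

section \<open>Flows and cuts\<close>

text \<open>Weak duality bounds the cuts left after a deletion from below. To compare them with the
  cuts of \<open>G\<close>, the other half of duality is also needed: a maximum flow admits a cut of
  \<open>G\<close> no larger than its value. The time bound is what shapes the algorithm. The arcs
  of \<open>H\<close> come unordered, and \<open>G\<close> may have far more than \<open>n\<close>
  arcs, so neither a scan of all arcs of \<open>G\<close> nor a search for the next arc at every
  step is affordable. The successor on the cycle must come from constant-time arithmetic on one cell
  per vertex. Since memory starts with arbitrary contents, these cells are cleared first, at cost
  linear in \<open>n\<close>; all other loops run once per arc of the cycle, and a cycle has as many
  arcs as vertices.\<close>

context fin_digraph
begin

text \<open>A single sum over all arcs is visibly linear in \<open>g\<close>, and a loop contributes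
  zero to it. Later computations with net outflow go through this form.\<close>

lemma net_outflow_eq_sum:
  "net_outflow G g v = (\<Sum>e\<in>arcs G. g e * (of_bool (tail G e = v) - of_bool (head G e = v)))"
proof -
  have "(\<Sum>e \<in> out_arcs G v. g e) = (\<Sum>e\<in>arcs G. g e * of_bool (tail G e = v))"
    by (simp add: out_arcs_def of_bool_def sum.If_cases if_distrib cong: if_cong)
       (rule sum.cong, auto)
  moreover have "(\<Sum>e \<in> in_arcs G v. g e) = (\<Sum>e\<in>arcs G. g e * of_bool (head G e = v))"
    by (simp add: in_arcs_def of_bool_def sum.If_cases if_distrib cong: if_cong)
       (rule sum.cong, auto)
  ultimately show ?thesis
    by (simp add: net_outflow_def right_diff_distrib sum_subtractf)
qed

lemma net_outflow_add:
  "net_outflow G (\<lambda>e. g e + a * d e) v = net_outflow G g v + a * net_outflow G d v"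
  by (simp add: net_outflow_eq_sum distrib_right sum.distrib sum_distrib_left mult.assoc)

lemma cut_cap_eq_sum:
  "cut_cap G w C = (\<Sum>e\<in>arcs G. w e * of_bool (tail G e \<in> C \<and> head G e \<notin> C))"
  unfolding cut_cap_def
  by (simp add: of_bool_def sum.If_cases if_distrib cong: if_cong)
     (rule sum.cong, auto)

text \<open>Summing net outflow over \<open>C\<close> leaves only the source, by conservation and
  \<open>t \<notin> C\<close>. Exchanging the sums then cancels every arc with both ends in
  \<open>C\<close>.\<close>

lemma net_outflow_source_eq_cut:
  assumes C: "st_cut G s t C" and g: "st_flow G w s t g"
  shows "net_outflow G g s
    = (\<Sum>e\<in>arcs G. g e * (of_bool (tail G e \<in> C) - of_bool (head G e \<in> C)))"
proof -
  have fin: "finite C" and s: "s \<in> C"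
    using C finite_subset[OF _ finite_verts] by (auto simp: st_cut_def)
  have "(\<Sum>v\<in>C. net_outflow G g v) = net_outflow G g s + (\<Sum>v\<in>C - {s}. net_outflow G g v)"
    using fin s by (simp add: sum.remove)
  also have "(\<Sum>v\<in>C - {s}. net_outflow G g v) = 0"
    using C g by (intro sum.neutral) (auto simp: st_cut_def st_flow_def)
  finally have "net_outflow G g s = (\<Sum>v\<in>C. net_outflow G g v)" by simp
  also have "\<dots> = (\<Sum>e\<in>arcs G. g e * (\<Sum>v\<in>C. of_bool (tail G e = v) - of_bool (head G e = v)))"
    unfolding net_outflow_eq_sum by (subst sum.swap) (simp add: sum_distrib_left)
  also have "\<dots> = (\<Sum>e\<in>arcs G. g e * (of_bool (tail G e \<in> C) - of_bool (head G e \<in> C)))"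
    using fin by (simp add: sum_subtractf of_bool_def)
  finally show ?thesis .
qed

text \<open>Weak duality holds arc by arc: an arc leaving \<open>C\<close> contributes
  \<open>g e \<le> w e\<close>, an arc entering it \<open>- g e \<le> 0\<close>, any other arc
  nothing.\<close>

lemma flow_value_le_cut_cap:
  assumes "st_cut G s t C" "st_flow G w s t g"
  shows "net_outflow G g s \<le> cut_cap G w C"
  unfolding net_outflow_source_eq_cut[OF assms] cut_cap_eq_sum
  using assms(2) by (intro sum_mono) (force simp: st_flow_def of_bool_def)

lemma finite_st_cuts: "finite {C. st_cut G s t C}"
  by (rule finite_subset[of _ "Pow (verts G)"]) (auto simp: st_cut_def)

text \<open>The direction \<open>d\<close> ships one unit from \<open>s\<close> to \<open>t\<close>
  and respects the residual signs. A small positive multiple of it can therefore be added to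
  \<open>g\<close>, which raises the value.\<close>

lemma flow_augment:
  assumes g: "st_flow G w s t g" and "s \<noteq> t" "s \<in> verts G"
    and div: "\<And>x. x \<in> verts G \<Longrightarrow> net_outflow G d x = of_bool (x = s) - of_bool (x = t)"
    and up: "\<And>e. e \<in> arcs G \<Longrightarrow> 0 < d e \<Longrightarrow> g e < w e"
    and down: "\<And>e. e \<in> arcs G \<Longrightarrow> d e < 0 \<Longrightarrow> 0 < g e"
  shows "\<not> max_flow G w s t g"
proof -
  have "\<exists>b>0. \<forall>a>0. a < b \<longrightarrow> 0 \<le> g e + a * d e \<and> g e + a * d e \<le> w e"
    if e: "e \<in> arcs G" for e
  proof -
    have ge: "0 \<le> g e" "g e \<le> w e" using g e by (auto simp: st_flow_def)
    consider "d e = 0" | "0 < d e" | "d e < 0" by linarith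
    then show ?thesis
    proof cases
      case 1
      then show ?thesis using ge by (intro exI[of _ 1]) auto
    next
      case 2
      then show ?thesis using ge up[OF e]
        by (intro exI[of _ "(w e - g e) / d e"]) (auto simp: field_simps)
    next
      case 3
      have "0 \<le> g e + a * d e \<and> g e + a * d e \<le> w e" if "0 < a" "a < g e / (- d e)" for a
        using ge 3 that mult_pos_neg[of a "d e"] by (simp add: field_simps)
      moreover have "0 < g e / (- d e)"
        using 3 down[OF e] by (simp add: divide_pos_neg)
      ultimately show ?thesis by blast
    qed
  qed
  \<comment> \<open>Each arc has its own bound on the step size; finiteness of \<open>arcs G\<close>
    merges them into one.\<close>
  then have "\<forall>e\<in>arcs G. eventually (\<lambda>a. 0 \<le> g e + a * d e \<and> g e + a * d e \<le> w e) (at_right 0)"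
    unfolding eventually_at_right_field by blast
  then have "eventually (\<lambda>a. \<forall>e\<in>arcs G. 0 \<le> g e + a * d e \<and> g e + a * d e \<le> w e)
      (at_right (0::real))"
    by (intro eventually_ball_finite) auto
  then obtain b where "b > 0"
    and b: "\<And>a. 0 < a \<Longrightarrow> a < b \<Longrightarrow> \<forall>e\<in>arcs G. 0 \<le> g e + a * d e \<and> g e + a * d e \<le> w e"
    unfolding eventually_at_right_field by blast
  define a where "a = b / 2"
  have a: "0 < a" "a < b" using \<open>b > 0\<close> by (auto simp: a_def)
  have "st_flow G w s t (\<lambda>e. g e + a * d e)"
    using b[OF a] g div by (auto simp: st_flow_def net_outflow_add)
  moreover have "net_outflow G (\<lambda>e. g e + a * d e) s > net_outflow G g s"
    using a div \<open>s \<noteq> t\<close> \<open>s \<in> verts G\<close> by (simp add: net_outflow_add)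
  ultimately show ?thesis by (force simp: max_flow_def)
qed

text \<open>
  The cut consists of the vertices \<open>v\<close> to which some feasible direction ships one unit from the
  source. Directions need not come from residual paths, so the set is closed under residual arcs
  without any path argument.
\<close>

lemma max_flow_cut:
  assumes g: "max_flow G w s t g" and s: "s \<in> verts G" and t: "t \<in> verts G" and st: "s \<noteq> t"
  obtains C where "st_cut G s t C" "cut_cap G w C \<le> net_outflow G g s"
proof -
  have flow: "st_flow G w s t g" using g by (simp add: max_flow_def)
  define dir where "dir v d \<longleftrightarrow>
      (\<forall>x\<in>verts G. net_outflow G d x = of_bool (x = s) - of_bool (x = v)) \<and>
      (\<forall>e\<in>arcs G. (0 < d e \<longrightarrow> g e < w e) \<and> (d e < 0 \<longrightarrow> 0 < g e))" for v and d :: "'b \<Rightarrow> real"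
  define C where "C = {v \<in> verts G. \<exists>d. dir v d}"
  have "dir s (\<lambda>_. 0)" by (simp add: dir_def net_outflow_eq_sum)
  then have sC: "s \<in> C" using s by (auto simp: C_def)
  have "\<not> dir t d" for d
    using flow_augment[OF flow st s, of d] g unfolding dir_def by blast
  then have "t \<notin> C" by (simp add: C_def)
  with sC have cut: "st_cut G s t C" by (auto simp: st_cut_def C_def)
  \<comment> \<open>An arc \<open>e\<close> moves the destination of a direction from
    \<open>x\<close> to \<open>y\<close>. The case \<open>a = 1\<close> uses \<open>e\<close>
    forwards, \<open>a = -1\<close> backwards; \<open>ends\<close> covers both.\<close>
  have step: "dir y (\<lambda>e'. d e' + a * of_bool (e' = e))"
    if d: "dir x d" and e: "e \<in> arcs G"
      and ends: "\<And>z. a * (of_bool (tail G e = z) - of_bool (head G e = z))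
        = of_bool (x = z) - of_bool (y = z)"
      and res: "0 < a \<longrightarrow> g e < w e" "a < 0 \<longrightarrow> 0 < g e" for x y d a e
  proof -
    have "net_outflow G (\<lambda>e'. of_bool (e' = e)) z = of_bool (tail G e = z) - of_bool (head G e = z)"
      for z
    proof -
      have "net_outflow G (\<lambda>e'. of_bool (e' = e)) z = (\<Sum>e'\<in>arcs G.
          if e' = e then of_bool (tail G e = z) - of_bool (head G e = z) else 0)"
        unfolding net_outflow_eq_sum by (intro sum.cong) auto
      then show ?thesis using e by simp
    qed
    then have "net_outflow G (\<lambda>e'. d e' + a * of_bool (e' = e)) z = of_bool (z = s) - of_bool (z = y)"
      if "z \<in> verts G" for z
      using d that ends[of z] by (auto simp: dir_def net_outflow_add)
    then show ?thesis using d e res by (auto simp: dir_def)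
  qed
  have out: "g e = w e" if e: "e \<in> arcs G" and ends: "tail G e \<in> C" "head G e \<notin> C" for e
  proof (rule ccontr)
    assume "g e \<noteq> w e"
    then have "g e < w e" using flow e by (force simp: st_flow_def)
    obtain d where "dir (tail G e) d" using ends by (auto simp: C_def)
    from step[OF this e, of 1] \<open>g e < w e\<close> have "dir (head G e) (\<lambda>e'. d e' + 1 * of_bool (e' = e))"
      by simp
    then show False using ends e by (auto simp: C_def)
  qed
  have into: "g e = 0" if e: "e \<in> arcs G" and ends: "tail G e \<notin> C" "head G e \<in> C" for e
  proof (rule ccontr)
    assume "g e \<noteq> 0"
    then have "0 < g e" using flow e by (force simp: st_flow_def)
    obtain d where "dir (head G e) d" using ends by (auto simp: C_def)
    from step[OF this e, of "-1"] \<open>0 < g e\<close> have "dir (tail G e) (\<lambda>e'. d e' + (-1) * of_bool (e' = e))"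
      by simp
    then show False using ends e by (auto simp: C_def)
  qed
  \<comment> \<open>Arcs leaving \<open>C\<close> are saturated and arcs entering it are empty, so
    the estimate of weak duality is an equality in every term.\<close>
  have "cut_cap G w C = net_outflow G g s"
    unfolding net_outflow_source_eq_cut[OF cut flow] cut_cap_eq_sum
    by (intro sum.cong) (auto simp: of_bool_def out into)
  with cut show thesis by (intro that) auto
qed

end

section \<open>Arcs without flow are not vital\<close>

context st_network
begin

text \<open>The value of \<open>g\<close> separates the two minima: \<open>max_flow_cut\<close> puts
  the minimum for \<open>G\<close> below it, and weak duality puts the minimum after deletion above
  it.\<close>

lemma zero_flow_not_vital:
  assumes g: "max_flow G w s t g" and "g e = 0"
  shows "\<not> vital G w s t e"
proof
  assume "vital G w s t e"
  then have e: "e \<in> arcs G"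
    and less: "min_cut_cap (pre_digraph.del_arc G e) w s t < min_cut_cap G w s t"
    by (auto simp: vital_def)
  let ?G = "pre_digraph.del_arc G e"
  interpret D: fin_digraph ?G by (rule fin_digraph_del_arc)
  have net: "net_outflow ?G g v = net_outflow G g v" for v
    unfolding D.net_outflow_eq_sum net_outflow_eq_sum
    using \<open>g e = 0\<close> by (intro sum.mono_neutral_cong_left) auto
  have flow: "st_flow ?G w s t g"
    using g net by (auto simp: st_flow_def max_flow_def)
  obtain C where C: "st_cut G s t C" "cut_cap G w C \<le> net_outflow G g s"
    using max_flow_cut[OF g source_in_verts sink_in_verts source_neq_sink] .
  have "min_cut_cap G w s t \<le> net_outflow G g s"
    using C finite_st_cuts unfolding min_cut_cap_def
    by (intro order_trans[OF Min_le C(2)]) auto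
  also have "\<dots> \<le> min_cut_cap ?G w s t"
    unfolding min_cut_cap_def
  proof (subst Min_ge_iff)
    show "finite (cut_cap ?G w ` {C. st_cut ?G s t C})" using D.finite_st_cuts by blast
    show "cut_cap ?G w ` {C. st_cut ?G s t C} \<noteq> {}"
      using C(1) by (auto simp: st_cut_def)
    show "\<forall>c\<in>cut_cap ?G w ` {C. st_cut ?G s t C}. net_outflow G g s \<le> c"
      using D.flow_value_le_cut_cap[OF _ flow] net by auto
  qed
  finally show False using less by simp
qed

end

section \<open>Pushing flow along a cycle\<close>

text \<open>Functions on indices with \<open>u k = u 0\<close> avoid the modulus of
  \<open>underlying_cycle\<close>. Ends are compared as sets, so the walk may traverse an arc in
  either direction.\<close>

definition cyclic_walk ::
    "('v, 'e) pre_digraph \<Rightarrow> nat \<Rightarrow> (nat \<Rightarrow> 'v) \<Rightarrow> (nat \<Rightarrow> 'e) \<Rightarrow> bool" where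
  "cyclic_walk H k u c \<longleftrightarrow> inj_on u {..<k} \<and> u k = u 0 \<and> bij_betw c {..<k} (arcs H) \<and>
     (\<forall>j<k. {tail H (c j), head H (c j)} = {u j, u (Suc j)})"

text \<open>The program starts at the tail of the first listed arc. The given cyclic order is
  therefore rotated to begin with \<open>e\<close>, and reversed if it would enter \<open>e\<close>
  at its head.\<close>

lemma underlying_cycle_walk:
  assumes "underlying_cycle H" and e: "e \<in> arcs H"
  obtains u c where "cyclic_walk H (card (arcs H)) u c" "u 0 = tail H e" "c 0 = e"
proof -
  obtain us cs where us: "us \<noteq> []" "distinct us" "length cs = length us"
    and cs: "distinct cs" "set cs = arcs H"
    and ends: "\<And>i. i < length us \<Longrightarrow>
      {tail H (cs ! i), head H (cs ! i)} = {us ! i, us ! (Suc i mod length us)}"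
    using assms(1) unfolding underlying_cycle_def by blast
  define k where "k = length us"
  have k: "k > 0" "card (arcs H) = k" "length cs = k"
    using us distinct_card[OF cs(1)] by (auto simp: k_def cs(2))
  \<comment> \<open>Integer indices modulo \<open>k\<close> make rotation and reversal plain
    addition and subtraction.\<close>
  define U where "U z = us ! nat (z mod int k)" for z
  define C where "C z = cs ! nat (z mod int k)" for z
  have idx: "nat (z mod int k) < k" for z
    using k by (simp add: nat_less_iff)
  have U_eq: "U x = U y \<longleftrightarrow> x mod int k = y mod int k" for x y
    unfolding U_def using idx us k by (simp add: nth_eq_iff_index_eq k_def eq_nat_nat_iff)
  have C_eq: "C x = C y \<longleftrightarrow> x mod int k = y mod int k" for x y
    unfolding C_def using idx cs k by (simp add: nth_eq_iff_index_eq eq_nat_nat_iff)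
  have C_in: "C z \<in> arcs H" for z
    unfolding C_def using idx cs k by (metis nth_mem)
  have C_ends: "{tail H (C z), head H (C z)} = {U z, U (z + 1)}" for z
  proof -
    have "Suc (nat (z mod int k)) mod k = nat ((z + 1) mod int k)"
      using k by (simp add: nat_mod_as_int mod_simps add.commute)
    then show ?thesis using ends[of "nat (z mod int k)"] idx[of z] by (simp add: U_def C_def k_def)
  qed
  have mod_inj: "x = y" if "int x mod int k = int y mod int k" "x < k" "y < k" for x y
    using that by simp
  have diff_inj: "x = y" if "(a - int x) mod int k = (a - int y) mod int k" "x < k" "y < k" for x y a
  proof -
    have "int k dvd (a - int x) - (a - int y)" using that(1) by (simp add: mod_eq_dvd_iff)
    then have "int y mod int k = int x mod int k" by (simp add: mod_eq_dvd_iff)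
    then show ?thesis using mod_inj that by metis
  qed
  have add_inj: "x = y" if "(a + int x) mod int k = (a + int y) mod int k" "x < k" "y < k" for x y a
  proof -
    have "int k dvd (a + int x) - (a + int y)" using that(1) by (simp add: mod_eq_dvd_iff)
    then have "int x mod int k = int y mod int k" by (simp add: mod_eq_dvd_iff)
    then show ?thesis using mod_inj that by metis
  qed
  have bij: "bij_betw c {..<k} (arcs H)" if "inj_on c {..<k}" "range c \<subseteq> arcs H" for c
  proof -
    have "c ` {..<k} = arcs H"
      using that cs k by (intro card_subset_eq) (auto simp: card_image intro: card_ge_0_finite)
    then show ?thesis using that by (simp add: bij_betw_def)
  qed
  obtain i where i: "i < k" "cs ! i = e" using cs e k by (metis in_set_conv_nth)
  have Ci: "C (int i) = e" using i by (simp add: C_def)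
  consider "tail H e = U (int i)" | "tail H e = U (int i + 1)"
    using C_ends[of "int i"] Ci by blast
  then show thesis
  proof cases
    case 1
    show thesis
    proof (rule that[of "\<lambda>j. U (int i + int j)" "\<lambda>j. C (int i + int j)"])
      show "cyclic_walk H (card (arcs H)) (\<lambda>j. U (int i + int j)) (\<lambda>j. C (int i + int j))"
        unfolding cyclic_walk_def k
      proof (intro conjI allI impI)
        show "inj_on (\<lambda>j. U (int i + int j)) {..<k}"
          by (auto simp: inj_on_def U_eq intro: add_inj)
        show "U (int i + int k) = U (int i + int 0)" by (simp add: U_eq)
        show "bij_betw (\<lambda>j. C (int i + int j)) {..<k} (arcs H)"
          using C_in by (intro bij) (auto simp: inj_on_def C_eq intro: add_inj)
        show "{tail H (C (int i + int j)), head H (C (int i + int j))}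
            = {U (int i + int j), U (int i + int (Suc j))}" for j
          using C_ends[of "int i + int j"] by (simp add: ac_simps)
      qed
    qed (use 1 Ci in auto)
  next
    case 2
    show thesis
    \<comment> \<open>The arc \<open>C z\<close> joins \<open>U z\<close> to
      \<open>U (z + 1)\<close>. Walking backwards enters it at the larger index, so the vertex index
      runs one ahead of the arc index.\<close>
    proof (rule that[of "\<lambda>j. U (int i + 1 - int j)" "\<lambda>j. C (int i - int j)"])
      show "cyclic_walk H (card (arcs H)) (\<lambda>j. U (int i + 1 - int j)) (\<lambda>j. C (int i - int j))"
        unfolding cyclic_walk_def k
      proof (intro conjI allI impI)
        show "inj_on (\<lambda>j. U (int i + 1 - int j)) {..<k}"
          by (auto simp: inj_on_def U_eq intro: diff_inj)
        show "U (int i + 1 - int k) = U (int i + 1 - int 0)" by (simp add: U_eq)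
        show "bij_betw (\<lambda>j. C (int i - int j)) {..<k} (arcs H)"
          using C_in by (intro bij) (auto simp: inj_on_def C_eq intro: diff_inj)
        show "{tail H (C (int i - int j)), head H (C (int i - int j))}
            = {U (int i + 1 - int j), U (int i + 1 - int (Suc j))}" for j
          using C_ends[of "int i - int j"] by (simp add: algebra_simps insert_commute)
      qed
    qed (use 2 Ci in auto)
  qed
qed

lemma cyclic_walk_ends:
  assumes "cyclic_walk H k u c" "j < k"
  shows "tail H (c j) = u j \<and> head H (c j) = u (Suc j) \<or>
    tail H (c j) = u (Suc j) \<and> head H (c j) = u j"
  using assms unfolding cyclic_walk_def doubleton_eq_iff by blast

lemma cyclic_walk_incidences:
  assumes "cyclic_walk H k u c" "j < k"
  shows "of_bool (tail H (c j) = v) + of_bool (head H (c j) = v)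
    = of_bool (u j = v) + (of_bool (u (Suc j) = v) :: nat)"
  using cyclic_walk_ends[OF assms] by (elim disjE conjE) simp_all

text \<open>The amount by which the flow on the \<open>j\<close>-th arc can change when the walk is pushed forward.\<close>

definition residual ::
    "('v, 'e) pre_digraph \<Rightarrow> ('e \<Rightarrow> real) \<Rightarrow> ('e \<Rightarrow> real) \<Rightarrow> (nat \<Rightarrow> 'v) \<Rightarrow> (nat \<Rightarrow> 'e) \<Rightarrow> nat \<Rightarrow> real"
  where "residual G w f u c j = (if tail G (c j) = u j then w (c j) - f (c j) else f (c j))"

lemma slack_cycle_subgraph:
  assumes "slack_cycle G w f H"
  shows "arcs H \<subseteq> arcs G" "tail H = tail G" "head H = head G"
  using assms by (auto simp: slack_cycle_def subgraph_def compatible_def)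

context st_network
begin

lemma min_residual_non_loose:
  assumes f: "max_flow G w s t f" and H: "slack_cycle G w f H"
    and walk: "cyclic_walk H k u c" and i: "i < k"
    and least: "\<And>j. j < k \<Longrightarrow> residual G w f u c i \<le> residual G w f u c j"
  shows "non_loose G w s t (c i)"
proof -
  note sub = slack_cycle_subgraph[OF H]
  have inj: "inj_on c {..<k}" and arcsH: "arcs H = c ` {..<k}"
    using walk by (auto simp: cyclic_walk_def bij_betw_def)
  define \<delta> where "\<delta> = residual G w f u c i"
  have ci: "c i \<in> arcs H" using i arcsH by auto
  have "0 \<le> \<delta>"
    using ci H by (auto simp: \<delta>_def residual_def slack_cycle_def less_imp_le)
  \<comment> \<open>This is the unit circulation along the walk. The sign depends on the position of
    the arc in the walk, which \<open>the_inv_into\<close> recovers.\<close>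
  define d where "d e = (if e \<in> arcs H then
      (let j = the_inv_into {..<k} c e in if tail G e = u j then 1 else -1) else (0::real))" for e
  have d_c: "d (c j) = (if tail G (c j) = u j then 1 else -1)" if "j < k" for j
    using that inj arcsH by (auto simp: d_def the_inv_into_f_f)
  have d_out: "d e = 0" if "e \<notin> arcs H" for e using that by (simp add: d_def)
  have ends: "tail G (c j) = u j \<and> head G (c j) = u (Suc j) \<or>
      tail G (c j) = u (Suc j) \<and> head G (c j) = u j" if "j < k" for j
    using cyclic_walk_ends[OF walk that] sub by simp
  have "net_outflow G d v = 0" for v
  proof -
    have "net_outflow G d v
        = (\<Sum>e\<in>arcs H. d e * (of_bool (tail G e = v) - of_bool (head G e = v)))"
      unfolding net_outflow_eq_sum
      using sub d_out by (intro sum.mono_neutral_right) auto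
    also have "\<dots> = (\<Sum>j<k. d (c j) * (of_bool (tail G (c j) = v) - of_bool (head G (c j) = v)))"
      unfolding arcsH by (simp add: sum.reindex[OF inj])
    also have "\<dots> = (\<Sum>j<k. of_bool (u j = v) - of_bool (u (Suc j) = v))"
    proof (intro sum.cong refl)
      fix j assume "j \<in> {..<k}"
      then have "j < k" by simp
      then show "d (c j) * (of_bool (tail G (c j) = v) - of_bool (head G (c j) = v))
          = of_bool (u j = v) - of_bool (u (Suc j) = v)"
        using ends[OF \<open>j < k\<close>] by (elim disjE conjE) (auto simp: d_c[OF \<open>j < k\<close>])
    qed
    \<comment> \<open>With these signs the \<open>j\<close>-th arc carries a unit from
      \<open>u j\<close> to \<open>u (Suc j)\<close> whatever its orientation, so the sum telescopes
      around the closed walk.\<close>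
    also have "\<dots> = of_bool (u 0 = v) - of_bool (u k = v)"
      by (rule sum_lessThan_telescope')
    also have "\<dots> = 0" using walk by (simp add: cyclic_walk_def)
    finally show ?thesis .
  qed
  then have net: "net_outflow G (\<lambda>e. f e + \<delta> * d e) v = net_outflow G f v" for v
    by (simp add: net_outflow_add)
  define g where "g e = f e + \<delta> * d e" for e
  have "0 \<le> g e \<and> g e \<le> w e" if e: "e \<in> arcs G" for e
  proof (cases "e \<in> arcs H")
    case False
    then show ?thesis using f e by (simp add: g_def d_out max_flow_def st_flow_def)
  next
    case True
    then obtain j where j: "j < k" "e = c j" using arcsH by auto
    have "\<delta> \<le> residual G w f u c j" using least j by (simp add: \<delta>_def)
    moreover have "0 < f e" "f e < w e" using True H by (auto simp: slack_cycle_def)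
    ultimately show ?thesis using \<open>0 \<le> \<delta>\<close> j d_c[of j] by (auto simp: g_def residual_def split: if_splits)
  qed
  then have g: "max_flow G w s t g"
    using f net unfolding g_def[abs_def] by (auto simp: max_flow_def st_flow_def)
  \<comment> \<open>A forward minimum gives \<open>f + (w - f)\<close>, a backward one
    \<open>f - f\<close>. In the first case \<open>g\<close> itself witnesses tightness if the arc
    is vital.\<close>
  have "g (c i) = w (c i) \<or> g (c i) = 0"
    using d_c[OF i] by (auto simp: g_def \<delta>_def residual_def)
  then show ?thesis
    using g zero_flow_not_vital[OF g, of "c i"] ci sub by (auto simp: non_loose_def tight_def)
qed

end

section \<open>Reasoning about programs\<close>

lemma nats_nset [simp]: "nats (nset x i a \<sigma>) y j = (if y = x \<and> j = i then a else nats \<sigma> y j)"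
  by (simp add: nset_def)

lemma reals_nset [simp]: "reals (nset x i a \<sigma>) = reals \<sigma>"
  by (simp add: nset_def)

lemma reals_rset [simp]: "reals (rset x i a \<sigma>) y j = (if y = x \<and> j = i then a else reals \<sigma> y j)"
  by (simp add: rset_def)

lemma nats_rset [simp]: "nats (rset x i a \<sigma>) = nats \<sigma>"
  by (simp add: rset_def)

text \<open>A program without loops always halts, its final memory can be computed by
  simplification, and its cost has a bound independent of the memory. Only the three loops of the
  algorithm then need invariants.\<close>

primrec loop_free :: "com \<Rightarrow> bool" where
  "loop_free Skip \<longleftrightarrow> True"
| "loop_free (NSet x i a) \<longleftrightarrow> True"
| "loop_free (RSet x i a) \<longleftrightarrow> True"
| "loop_free (Seq P Q) \<longleftrightarrow> loop_free P \<and> loop_free Q"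
| "loop_free (If b P Q) \<longleftrightarrow> loop_free P \<and> loop_free Q"
| "loop_free (While b P) \<longleftrightarrow> False"

text \<open>The equations for \<open>While\<close> in the next two functions are junk.\<close>

primrec run :: "com \<Rightarrow> mem \<Rightarrow> mem" where
  "run Skip \<sigma> = \<sigma>"
| "run (NSet x i a) \<sigma> = nset x (nval i \<sigma>) (nval a \<sigma>) \<sigma>"
| "run (RSet x i a) \<sigma> = rset x (nval i \<sigma>) (rval a \<sigma>) \<sigma>"
| "run (Seq P Q) \<sigma> = run Q (run P \<sigma>)"
| "run (If b P Q) \<sigma> = (if bval b \<sigma> then run P \<sigma> else run Q \<sigma>)"
| "run (While b P) \<sigma> = \<sigma>"

primrec max_cost :: "com \<Rightarrow> nat" where
  "max_cost Skip = 1"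
| "max_cost (NSet x i a) = 1 + ncost i + ncost a"
| "max_cost (RSet x i a) = 1 + ncost i + rcost a"
| "max_cost (Seq P Q) = 1 + max_cost P + max_cost Q"
| "max_cost (If b P Q) = 1 + bcost b + max (max_cost P) (max_cost Q)"
| "max_cost (While b P) = 0"

lemma exec_loop_free:
  assumes "loop_free P"
  shows "\<exists>k\<le>max_cost P. exec P \<sigma> k (run P \<sigma>)"
  using assms
proof (induction P arbitrary: \<sigma>)
  case Skip
  show ?case using exec_Skip[of \<sigma>] by auto
next
  case (NSet x i a)
  show ?case using exec_NSet[of x i a \<sigma>] by auto
next
  case (RSet x i a)
  show ?case using exec_RSet[of x i a \<sigma>] by auto
next
  case (Seq P Q)
  obtain k l where k: "k \<le> max_cost P" "exec P \<sigma> k (run P \<sigma>)"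
    and l: "l \<le> max_cost Q" "exec Q (run P \<sigma>) l (run Q (run P \<sigma>))"
    using Seq.IH(1)[of \<sigma>] Seq.IH(2)[of "run P \<sigma>"] Seq.prems by auto
  then show ?case
    using exec_Seq[OF k(2) l(2)] by (intro exI[of _ "1 + k + l"]) simp
next
  case (If b P Q)
  show ?case
  proof (cases "bval b \<sigma>")
    case True
    obtain k where k: "k \<le> max_cost P" "exec P \<sigma> k (run P \<sigma>)"
      using If.IH(1)[of \<sigma>] If.prems by auto
    then show ?thesis using True exec_If_True[OF True k(2)]
      by (intro exI[of _ "1 + bcost b + k"]) simp
  next
    case False
    obtain k where k: "k \<le> max_cost Q" "exec Q \<sigma> k (run Q \<sigma>)"
      using If.IH(2)[of \<sigma>] If.prems by auto
    then show ?thesis using False exec_If_False[OF False k(2)]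
      by (intro exI[of _ "1 + bcost b + k"]) simp
  qed
next
  case (While b P)
  then show ?case by simp
qed

text \<open>The invariant is indexed by the number of completed iterations, and induction runs over
  the \<open>K - j\<close> remaining ones. The summand \<open>1 + bcost b\<close> pays for the final
  failing test.\<close>

lemma exec_While_counting:
  assumes "loop_free P"
    and test: "\<And>j \<sigma>. I j \<sigma> \<Longrightarrow> bval b \<sigma> \<longleftrightarrow> j < K"
    and step: "\<And>j \<sigma>. j < K \<Longrightarrow> I j \<sigma> \<Longrightarrow> I (Suc j) (run P \<sigma>)"
    and "I j \<sigma>" "j \<le> K"
  shows "\<exists>k \<sigma>'. exec (While b P) \<sigma> k \<sigma>' \<and> I K \<sigma>' \<and>
    k \<le> (1 + bcost b) + (K - j) * (1 + bcost b + max_cost P)"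
  using assms(4,5)
proof (induction "K - j" arbitrary: j \<sigma>)
  case 0
  then have "\<not> bval b \<sigma>" "j = K" using test by auto
  then show ?case using 0 exec_While_False[of b \<sigma> P] by fastforce
next
  case (Suc d)
  then have "j < K" and d: "K - j = Suc d" "K - Suc j = d" by auto
  then have "bval b \<sigma>" and I: "I (Suc j) (run P \<sigma>)" using test step Suc.prems by auto
  obtain k where k: "k \<le> max_cost P" "exec P \<sigma> k (run P \<sigma>)"
    using exec_loop_free[OF assms(1)] by blast
  obtain l \<sigma>' where "exec (While b P) (run P \<sigma>) l \<sigma>'" "I K \<sigma>'"
    "l \<le> (1 + bcost b) + d * (1 + bcost b + max_cost P)"
    using Suc.hyps(1)[OF d(2)[symmetric] I] \<open>j < K\<close> d by auto
  then show ?case unfolding d(1)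
    using exec_While_True[OF \<open>bval b \<sigma>\<close> k(2)] k(1)
    by (intro exI[of _ "1 + bcost b + k + l"] exI[of _ \<sigma>']) auto
qed

text \<open>The failing test is charged as one more full iteration, hence
  \<open>Suc K\<close>.\<close>

lemma exec_counting_loop:
  assumes "loop_free P" "\<And>j \<sigma>. I j \<sigma> \<Longrightarrow> bval b \<sigma> \<longleftrightarrow> j < K"
    "\<And>j \<sigma>. j < K \<Longrightarrow> I j \<sigma> \<Longrightarrow> I (Suc j) (run P \<sigma>)" "I 0 \<sigma>"
    and C: "1 + bcost b + max_cost P \<le> C"
  obtains k \<sigma>' where "exec (While b P) \<sigma> k \<sigma>'" "I K \<sigma>'" "k \<le> C * Suc K"
proof -
  obtain k \<sigma>' where k: "exec (While b P) \<sigma> k \<sigma>'" "I K \<sigma>'"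
    "k \<le> (1 + bcost b) + (K - 0) * (1 + bcost b + max_cost P)"
    using exec_While_counting[OF assms(1-4)] by blast
  have "K * (1 + bcost b + max_cost P) \<le> K * C"
    using C by (rule mult_le_mono2)
  with k(3) C have "k \<le> C * Suc K" by (simp add: mult.commute)
  with k(1,2) show thesis by (rule that)
qed

section \<open>The algorithm\<close>

abbreviation var :: "string \<Rightarrow> nexp" where "var x \<equiv> NGet x (NConst 0)"
abbreviation assign :: "string \<Rightarrow> nexp \<Rightarrow> com" where "assign x a \<equiv> NSet x (NConst 0) a"
abbreviation rassign :: "string \<Rightarrow> rexp \<Rightarrow> com" where "rassign x a \<equiv> RSet x (NConst 0) a"

definition increment :: com where
  "increment = assign ''i'' (NAdd (var ''i'') (NConst 1))"

definition clear_body :: com where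
  "clear_body = Seq (NSet ''S'' (var ''i'') (NConst 0)) increment"

text \<open>
  Every vertex of the cycle has exactly two incidences, so the sum \<open>S\<close> of the numbers of its
  incident arcs determines each of these arcs from the other one.
\<close>

definition sum_body :: com where
  "sum_body =
     Seq (assign ''e'' (NGet ''H'' (var ''i'')))
    (Seq (NSet ''S'' (NGet ''tail'' (var ''e''))
           (NAdd (NGet ''S'' (NGet ''tail'' (var ''e''))) (var ''e'')))
    (Seq (NSet ''S'' (NGet ''head'' (var ''e''))
           (NAdd (NGet ''S'' (NGet ''head'' (var ''e''))) (var ''e'')))
      increment))"

text \<open>Starting at its tail, the walk traverses the first arc forwards, so \<open>w - f\<close>
  is the first candidate for the minimum.\<close>

definition init_walk :: com where
  "init_walk =
     Seq (assign ''i'' (NConst 0))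
    (Seq (assign ''e'' (NGet ''H'' (NConst 0)))
    (Seq (assign ''v'' (NGet ''tail'' (var ''e'')))
    (Seq (assign ''out'' (var ''e''))
      (rassign ''best'' (RSub (RGet ''w'' (var ''e'')) (RGet ''f'' (var ''e'')))))))"

text \<open>Equality of vertex numbers is tested by two negated comparisons, as \<open>bexp\<close>
  has no equality. The other end of \<open>e\<close> is \<open>tail + head - v\<close>, which also
  works for a loop.\<close>

definition walk_body :: com where
  "walk_body =
     Seq (If (And (Not (NLess (NGet ''tail'' (var ''e'')) (var ''v'')))
                  (Not (NLess (var ''v'') (NGet ''tail'' (var ''e'')))))
           (rassign ''r'' (RSub (RGet ''w'' (var ''e'')) (RGet ''f'' (var ''e''))))
           (rassign ''r'' (RGet ''f'' (var ''e''))))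
    (Seq (If (RLess (RGet ''r'' (NConst 0)) (RGet ''best'' (NConst 0)))
           (Seq (rassign ''best'' (RGet ''r'' (NConst 0))) (assign ''out'' (var ''e'')))
           Skip)
    (Seq (assign ''v'' (NSub (NAdd (NGet ''tail'' (var ''e'')) (NGet ''head'' (var ''e'')))
                             (var ''v'')))
    (Seq (assign ''e'' (NSub (NGet ''S'' (var ''v'')) (var ''e'')))
      increment)))"

definition find_non_loose :: com where
  "find_non_loose =
     Seq (assign ''i'' (NConst 0))
    (Seq (While (NLess (var ''i'') (var ''n'')) clear_body)
    (Seq (assign ''i'' (NConst 0))
    (Seq (While (NLess (var ''i'') (var ''k'')) sum_body)
    (Seq init_walk
      (While (NLess (var ''i'') (var ''k'')) walk_body)))))"

section \<open>Numberings, cost constants and frame rules\<close>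

definition number :: "'a list \<Rightarrow> 'a \<Rightarrow> nat" where
  "number xs x = (THE i. numbers xs i x)"

lemma numbers_iff_number:
  assumes "distinct xs"
  shows "numbers xs i x \<longleftrightarrow> x \<in> set xs \<and> i = number xs x"
proof -
  have uniq: "number xs x = j" if "numbers xs j x" for j
    unfolding number_def
    using assms that by (intro the_equality) (auto simp: numbers_def nth_eq_iff_index_eq)
  show ?thesis
  proof
    assume "numbers xs i x"
    then show "x \<in> set xs \<and> i = number xs x" using uniq by (auto simp: numbers_def)
  next
    assume x: "x \<in> set xs \<and> i = number xs x"
    then obtain j where "numbers xs j x" by (auto simp: in_set_conv_nth numbers_def)
    then show "numbers xs i x" using uniq x by auto
  qed
qed

text \<open>The bounds are round; 90 leaves room for the 6 units of a loop test within 100 per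
  iteration.\<close>

lemma body_costs:
  "max_cost clear_body \<le> 90" "max_cost sum_body \<le> 90" "max_cost walk_body \<le> 90"
  by code_simp+

lemma init_walk_cost: "max_cost init_walk \<le> 100"
  by code_simp

lemma iteration_costs:
  "1 + bcost (NLess (var x) (var y)) + max_cost clear_body \<le> 100"
  "1 + bcost (NLess (var x) (var y)) + max_cost sum_body \<le> 100"
  "1 + bcost (NLess (var x) (var y)) + max_cost walk_body \<le> 100"
  using body_costs by simp_all

lemma loop_free_bodies: "loop_free clear_body" "loop_free sum_body" "loop_free walk_body"
  and loop_free_init_walk: "loop_free init_walk"
  by (simp_all add: clear_body_def sum_body_def walk_body_def init_walk_def increment_def)

lemma nth_number:
  assumes "distinct xs" "x \<in> set xs"
  shows "xs ! number xs x = x"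
  using numbers_iff_number[OF assms(1), of "number xs x" x] assms(2) by (simp add: numbers_def)

lemma number_eq_iff:
  assumes "distinct xs" "x \<in> set xs" "y \<in> set xs"
  shows "number xs x = number xs y \<longleftrightarrow> x = y"
  using nth_number[OF assms(1,2)] nth_number[OF assms(1,3)] by metis

text \<open>A frame rule: the excluded names are the arrays of naturals that hold the input.\<close>

lemma input_mem_nset:
  assumes "x \<notin> {''n'', ''m'', ''k'', ''s'', ''t'', ''tail'', ''head'', ''H''}"
  shows "input_mem G w s t f H vs es hs (nset x i a \<sigma>) = input_mem G w s t f H vs es hs \<sigma>"
proof -
  have "nats (nset x i a \<sigma>) y = nats \<sigma> y"
    if "y \<in> {''n'', ''m'', ''k'', ''s'', ''t'', ''tail'', ''head'', ''H''}" for y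
    using that assms by (force simp: nset_def)
  then show ?thesis by (simp add: input_mem_def del: nats_nset)
qed

lemma input_mem_rset:
  assumes "x \<notin> {''w'', ''f''}"
  shows "input_mem G w s t f H vs es hs (rset x i a \<sigma>) = input_mem G w s t f H vs es hs \<sigma>"
proof -
  have "reals (rset x i a \<sigma>) y = reals \<sigma> y"
    if "y \<in> {''w'', ''f''}" for y
    using that assms by (force simp: rset_def)
  then show ?thesis by (simp add: input_mem_def del: reals_rset)
qed

section \<open>Loop invariants, correctness and running time\<close>

locale cycle_input = st_network G w s t
  for G :: "('v, 'e) pre_digraph" and w s t +
  fixes f :: "'e \<Rightarrow> real" and H :: "('v, 'e) pre_digraph" and vs :: "'v list" and es hs :: "'e list"
  assumes max_flow: "max_flow G w s t f"
    and slack: "slack_cycle G w f H"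
    and vs: "distinct vs" "set vs = verts G"
    and es: "distinct es" "set es = arcs G"
    and hs: "distinct hs" "set hs = arcs H"
begin

abbreviation loaded :: "mem \<Rightarrow> bool" where
  "loaded \<equiv> input_mem G w s t f H vs es hs"

abbreviation vnum :: "'v \<Rightarrow> nat" where "vnum \<equiv> number vs"
abbreviation anum :: "'e \<Rightarrow> nat" where "anum \<equiv> number es"

lemmas sub = slack_cycle_subgraph[OF slack]

lemma loaded_scalars:
  assumes "loaded \<sigma>"
  shows "nats \<sigma> ''n'' 0 = length vs" "nats \<sigma> ''k'' 0 = length hs"
  using assms by (auto simp: input_mem_def)

lemma loaded_arc:
  assumes \<sigma>: "loaded \<sigma>" and e: "e \<in> arcs G"
  shows "nats \<sigma> ''tail'' (anum e) = vnum (tail G e)"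
    and "nats \<sigma> ''head'' (anum e) = vnum (head G e)"
    and "reals \<sigma> ''w'' (anum e) = w e"
    and "reals \<sigma> ''f'' (anum e) = f e"
proof -
  have "numbers es (anum e) e" using e es by (simp add: numbers_iff_number)
  then have "anum e < length es" "es ! anum e = e" by (auto simp: numbers_def)
  then show "nats \<sigma> ''tail'' (anum e) = vnum (tail G e)"
    and "nats \<sigma> ''head'' (anum e) = vnum (head G e)"
    and "reals \<sigma> ''w'' (anum e) = w e"
    and "reals \<sigma> ''f'' (anum e) = f e"
    using \<sigma> vs numbers_iff_number[OF vs(1)] by (auto simp: input_mem_def)
qed

lemma loaded_cycle:
  assumes "loaded \<sigma>" "i < length hs"
  shows "nats \<sigma> ''H'' i = anum (hs ! i)"
  using assms numbers_iff_number[OF es(1)] by (auto simp: input_mem_def)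

lemma cycle_arc: "i < length hs \<Longrightarrow> hs ! i \<in> arcs G"
  using nth_mem[of i hs] hs sub(1) by auto

lemma vnum_eq_iff: "x \<in> verts G \<Longrightarrow> y \<in> verts G \<Longrightarrow> vnum x = vnum y \<longleftrightarrow> x = y"
  using number_eq_iff[OF vs(1)] vs(2) by simp

definition clear_inv :: "nat \<Rightarrow> mem \<Rightarrow> bool" where
  "clear_inv j \<sigma> \<longleftrightarrow> loaded \<sigma> \<and> nats \<sigma> ''i'' 0 = j \<and> (\<forall>a<j. nats \<sigma> ''S'' a = 0)"

lemma clear_step: "clear_inv j \<sigma> \<Longrightarrow> clear_inv (Suc j) (run clear_body \<sigma>)"
  by (simp add: clear_inv_def clear_body_def increment_def input_mem_nset less_Suc_eq)

text \<open>A loop counts twice, matching the two additions in \<open>sum_body\<close>.\<close>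

definition incidences :: "'e \<Rightarrow> 'v \<Rightarrow> nat" where
  "incidences e v = of_bool (tail G e = v) + of_bool (head G e = v)"

definition sum_inv :: "nat \<Rightarrow> mem \<Rightarrow> bool" where
  "sum_inv j \<sigma> \<longleftrightarrow> loaded \<sigma> \<and> nats \<sigma> ''i'' 0 = j \<and>
     (\<forall>v\<in>verts G. nats \<sigma> ''S'' (vnum v) = (\<Sum>l<j. anum (hs ! l) * incidences (hs ! l) v))"

lemma sum_step:
  assumes "j < length hs" and inv: "sum_inv j \<sigma>"
  shows "sum_inv (Suc j) (run sum_body \<sigma>)"
proof -
  let ?e = "hs ! j"
  have e: "?e \<in> arcs G" using cycle_arc assms by blast
  have ends: "tail G ?e \<in> verts G" "head G ?e \<in> verts G" using e by auto
  have \<sigma>: "loaded \<sigma>" "nats \<sigma> ''i'' 0 = j" using inv by (auto simp: sum_inv_def)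
  note facts = loaded_cycle[OF \<sigma>(1) assms(1)] loaded_arc[OF \<sigma>(1) e] \<sigma>(2)
  \<comment> \<open>Injectivity of \<open>vnum\<close> keeps the cells of different vertices apart;
    for a loop the second addition reads the cell already updated by the first.\<close>
  have S: "nats (run sum_body \<sigma>) ''S'' (vnum v)
      = nats \<sigma> ''S'' (vnum v) + anum ?e * incidences ?e v" if "v \<in> verts G" for v
    using vnum_eq_iff[OF that ends(1)] vnum_eq_iff[OF that ends(2)] vnum_eq_iff[OF ends]
    by (auto simp: sum_body_def increment_def facts incidences_def)
  have "loaded (run sum_body \<sigma>)"
    using \<sigma> by (simp add: sum_body_def increment_def input_mem_nset)
  moreover have "nats (run sum_body \<sigma>) ''i'' 0 = Suc j"
    using \<sigma> by (simp add: sum_body_def increment_def)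
  ultimately show ?thesis
    using inv S by (simp add: sum_inv_def)
qed

text \<open>Injectivity of \<open>u\<close> leaves \<open>c j\<close> and \<open>c (Suc j)\<close>
  as the only arcs at \<open>u (Suc j)\<close>. The bound \<open>Suc j < length hs\<close> keeps
  this vertex away from the closing point of the walk.\<close>

lemma sum_incidences:
  assumes walk: "cyclic_walk H (length hs) u c" and j: "Suc j < length hs"
  shows "(\<Sum>l<length hs. anum (hs ! l) * incidences (hs ! l) (u (Suc j)))
    = anum (c j) + anum (c (Suc j))"
proof -
  let ?k = "length hs" and ?v = "u (Suc j)"
  have inj: "inj_on u {..<?k}" and "u ?k = u 0" and c: "bij_betw c {..<?k} (arcs H)"
    using walk by (auto simp: cyclic_walk_def)
  have u1: "u l = ?v \<longleftrightarrow> l = Suc j" if "l < ?k" for l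
    using inj that j by (auto simp: inj_on_def)
  \<comment> \<open>The last index closes the walk at \<open>u 0\<close>, which differs from
    \<open>u (Suc j)\<close>.\<close>
  have u2: "u (Suc l) = ?v \<longleftrightarrow> l = j" if "l < ?k" for l
  proof (cases "Suc l = ?k")
    case True
    moreover have "u 0 \<noteq> ?v" using u1[of 0] j by linarith
    ultimately show ?thesis using j \<open>u ?k = u 0\<close> by auto
  next
    case False
    then show ?thesis using u1[of "Suc l"] that by auto
  qed
  have "(\<Sum>l<?k. anum (hs ! l) * incidences (hs ! l) ?v) = (\<Sum>e\<in>arcs H. anum e * incidences e ?v)"
    using hs by (intro sum.reindex_bij_betw) (simp add: bij_betw_nth)
  also have "\<dots> = (\<Sum>l<?k. anum (c l) * incidences (c l) ?v)"
    using c by (intro sum.reindex_bij_betw[symmetric])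
  also have "\<dots> = (\<Sum>l<?k. (if l = Suc j then anum (c l) else 0) + (if l = j then anum (c l) else 0))"
  proof (intro sum.cong refl)
    fix l assume "l \<in> {..<?k}"
    then have l: "l < ?k" by simp
    show "anum (c l) * incidences (c l) ?v
        = (if l = Suc j then anum (c l) else 0) + (if l = j then anum (c l) else 0)"
      using cyclic_walk_incidences[OF walk l, of ?v] sub u1[OF l] u2[OF l]
      by (simp add: incidences_def)
  qed
  also have "\<dots> = anum (c j) + anum (c (Suc j))"
    using j by (simp add: sum.distrib)
  finally show ?thesis .
qed

text \<open>The walk exists only in the proof; the program never stores it. The assumption
  \<open>start\<close> matches the choice made by \<open>init_walk\<close>.\<close>

context
  fixes u :: "nat \<Rightarrow> 'v" and c :: "nat \<Rightarrow> 'e"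
  assumes walk: "cyclic_walk H (length hs) u c"
    and start: "u 0 = tail G (hs ! 0)" "c 0 = hs ! 0"
    and nonempty: "0 < length hs"
begin

abbreviation res :: "nat \<Rightarrow> real" where "res \<equiv> residual G w f u c"

text \<open>The update of \<open>i\<close> is needed because \<open>sum_inv\<close> also fixes the loop counter.\<close>

definition walk_inv :: "nat \<Rightarrow> mem \<Rightarrow> bool" where
  "walk_inv j \<sigma> \<longleftrightarrow> sum_inv (length hs) (nset ''i'' 0 (length hs) \<sigma>) \<and> nats \<sigma> ''i'' 0 = j \<and>
     (j < length hs \<longrightarrow> nats \<sigma> ''v'' 0 = vnum (u j) \<and> nats \<sigma> ''e'' 0 = anum (c j)) \<and>
     (\<exists>l<length hs. nats \<sigma> ''out'' 0 = anum (c l) \<and> reals \<sigma> ''best'' 0 = res l) \<and>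
     (\<forall>l<j. reals \<sigma> ''best'' 0 \<le> res l)"

lemma walk_start:
  assumes "sum_inv (length hs) \<sigma>"
  shows "walk_inv 0 (run init_walk \<sigma>)"
proof -
  have \<sigma>: "loaded \<sigma>" using assms by (simp add: sum_inv_def)
  note facts = loaded_cycle[OF \<sigma> nonempty] loaded_arc[OF \<sigma> cycle_arc[OF nonempty]]
  have "sum_inv (length hs) (nset ''i'' 0 (length hs) (run init_walk \<sigma>))"
    using assms by (simp add: sum_inv_def init_walk_def input_mem_nset input_mem_rset)
  then show ?thesis
    using nonempty start facts
    by (auto simp: walk_inv_def init_walk_def residual_def intro!: exI[of _ 0])
qed

lemma walk_step:
  assumes j: "j < length hs" and inv: "walk_inv j \<sigma>"
  shows "walk_inv (Suc j) (run walk_body \<sigma>)"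
proof -
  let ?\<sigma>' = "run walk_body \<sigma>"
  have sum: "sum_inv (length hs) (nset ''i'' 0 (length hs) \<sigma>)"
    and i: "nats \<sigma> ''i'' 0 = j" and v: "nats \<sigma> ''v'' 0 = vnum (u j)"
    and e: "nats \<sigma> ''e'' 0 = anum (c j)"
    using inv j by (auto simp: walk_inv_def)
  obtain l where l: "l < length hs" "nats \<sigma> ''out'' 0 = anum (c l)" "reals \<sigma> ''best'' 0 = res l"
    using inv by (auto simp: walk_inv_def)
  have least: "res l \<le> res l'" if "l' < j" for l'
    using inv that l by (auto simp: walk_inv_def)
  have \<sigma>: "loaded \<sigma>" using sum by (simp add: sum_inv_def input_mem_nset)
  have cj: "c j \<in> arcs G"
    using walk j sub(1) by (auto simp: cyclic_walk_def bij_betw_def)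
  note facts = loaded_arc[OF \<sigma> cj] i v e
  have ends: "tail G (c j) = u j \<and> head G (c j) = u (Suc j) \<or>
      tail G (c j) = u (Suc j) \<and> head G (c j) = u j"
    using cyclic_walk_ends[OF walk j] sub by simp
  then have uj: "u j \<in> verts G" "u (Suc j) \<in> verts G" using cj by (metis wellformed)+
  have dir: "vnum (tail G (c j)) = vnum (u j) \<longleftrightarrow> tail G (c j) = u j"
    using cj uj by (intro vnum_eq_iff) auto
  have next_v: "vnum (tail G (c j)) + vnum (head G (c j)) - vnum (u j) = vnum (u (Suc j))"
    using ends by auto
  \<comment> \<open>No claim is made after the last arc: \<open>walk_inv\<close> describes
    \<open>v\<close> and \<open>e\<close> only while arcs remain.\<close>
  have next_e: "nats \<sigma> ''S'' (vnum (u (Suc j))) - anum (c j) = anum (c (Suc j))"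
    if "Suc j < length hs"
    using sum uj sum_incidences[OF walk that] by (simp add: sum_inv_def)
  have test: "\<not> a < b \<and> \<not> b < a \<longleftrightarrow> a = b" for a b :: nat by auto
  have "sum_inv (length hs) (nset ''i'' 0 (length hs) ?\<sigma>')"
    using sum by (simp add: sum_inv_def walk_body_def increment_def input_mem_nset input_mem_rset)
  moreover have "nats ?\<sigma>' ''i'' 0 = Suc j"
    by (simp add: walk_body_def increment_def i)
  moreover have "nats ?\<sigma>' ''v'' 0 = vnum (u (Suc j))"
    by (simp add: walk_body_def increment_def facts next_v)
  moreover have "Suc j < length hs \<Longrightarrow> nats ?\<sigma>' ''e'' 0 = anum (c (Suc j))"
    by (simp add: walk_body_def increment_def facts next_v next_e)
  moreover have "nats ?\<sigma>' ''out'' 0 = (if res j < res l then anum (c j) else anum (c l))"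
    by (simp add: walk_body_def increment_def facts test dir l residual_def)
  moreover have "reals ?\<sigma>' ''best'' 0 = (if res j < res l then res j else res l)"
    by (simp add: walk_body_def increment_def facts test dir l residual_def)
  moreover have "\<forall>l'<Suc j. (if res j < res l then res j else res l) \<le> res l'"
    using least by (force simp: less_Suc_eq)
  ultimately show ?thesis
    unfolding walk_inv_def using j l(1) by (cases "res j < res l") auto
qed

lemma walk_end:
  assumes "walk_inv (length hs) \<sigma>"
  shows "\<exists>e\<in>arcs H. numbers es (nats \<sigma> ''out'' 0) e \<and> non_loose G w s t e"
proof -
  obtain l where l: "l < length hs" "nats \<sigma> ''out'' 0 = anum (c l)" "reals \<sigma> ''best'' 0 = res l"
    using assms by (auto simp: walk_inv_def)
  have "non_loose G w s t (c l)"
    using assms l by (intro min_residual_non_loose[OF max_flow slack walk]) (auto simp: walk_inv_def)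
  moreover have "c l \<in> arcs H" using walk l(1) by (auto simp: cyclic_walk_def bij_betw_def)
  ultimately show ?thesis
    using l sub es numbers_iff_number[OF es(1)] by auto
qed

end

text \<open>A cycle has as many arcs as vertices. This turns the cost of the two loops over
  \<open>H\<close> into a bound in \<open>n\<close>.\<close>

lemma cycle_length_le: "length hs \<le> card (verts G)"
proof -
  obtain us cs where us: "length cs = length us" "distinct us" "set us = verts H"
    "distinct cs" "set cs = arcs H"
    using slack unfolding slack_cycle_def underlying_cycle_def by blast
  have "length hs = card (verts H)"
    using us hs by (metis distinct_card)
  also have "\<dots> \<le> card (verts G)"
    using slack by (intro card_mono) (auto simp: slack_cycle_def subgraph_def)
  finally show ?thesis .
qed

text \<open>The three loops cost at most \<open>100 * (n + 1)\<close> each, \<open>init_walk\<close>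
  at most 100, and the remaining commands 11 in all; the stated bound is generous.\<close>

lemma find_non_loose_correct:
  assumes \<sigma>: "loaded \<sigma>"
  obtains k \<sigma>' where "exec find_non_loose \<sigma> k \<sigma>'"
    "k \<le> 1000 + 1000 * card (verts G)"
    "\<exists>e\<in>arcs H. numbers es (nats \<sigma>' ''out'' 0) e \<and> non_loose G w s t e"
proof -
  let ?n = "length vs" and ?k = "length hs"
  have "underlying_cycle H" using slack by (simp add: slack_cycle_def)
  then have "arcs H \<noteq> {}" by (auto simp: underlying_cycle_def)
  then have nonempty: "0 < ?k" using hs by auto
  have card: "card (arcs H) = ?k" using hs by (metis distinct_card)
  have "hs ! 0 \<in> arcs H" using nonempty hs by (metis nth_mem)
  then obtain u c where walk: "cyclic_walk H ?k u c" and start: "u 0 = tail G (hs ! 0)" "c 0 = hs ! 0"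
    using underlying_cycle_walk[OF \<open>underlying_cycle H\<close>, of "hs ! 0"] sub unfolding card by metis
  define \<sigma>1 where "\<sigma>1 = nset ''i'' 0 0 \<sigma>"
  have e1: "exec (assign ''i'' (NConst 0)) \<sigma> 3 \<sigma>1"
    using exec_NSet[of "''i''" "NConst 0" "NConst 0" \<sigma>] by (simp add: \<sigma>1_def numeral_3_eq_3)
  have inv1: "clear_inv 0 \<sigma>1" using \<sigma> by (simp add: clear_inv_def \<sigma>1_def input_mem_nset)
  have test_clear: "bval (NLess (var ''i'') (var ''n'')) \<tau> \<longleftrightarrow> j < ?n"
    if "clear_inv j \<tau>" for j \<tau>
    using that by (simp add: clear_inv_def loaded_scalars)
  obtain k2 \<sigma>2 where e2: "exec (While (NLess (var ''i'') (var ''n'')) clear_body) \<sigma>1 k2 \<sigma>2"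
    and \<sigma>2: "clear_inv ?n \<sigma>2"
    and k2: "k2 \<le> 100 * Suc ?n"
    by (rule exec_counting_loop[OF loop_free_bodies(1) test_clear clear_step inv1 iteration_costs(1)])
  define \<sigma>3 where "\<sigma>3 = nset ''i'' 0 0 \<sigma>2"
  have e3: "exec (assign ''i'' (NConst 0)) \<sigma>2 3 \<sigma>3"
    using exec_NSet[of "''i''" "NConst 0" "NConst 0" \<sigma>2] by (simp add: \<sigma>3_def numeral_3_eq_3)
  \<comment> \<open>Every vertex number is below \<open>length vs\<close>, so the cleared cells
    include those of all vertices, as the empty sums require.\<close>
  have inv3: "sum_inv 0 \<sigma>3"
    using \<sigma>2 vs numbers_iff_number[OF vs(1)]
    by (auto simp: sum_inv_def clear_inv_def \<sigma>3_def input_mem_nset numbers_def)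
  have test_sum: "bval (NLess (var ''i'') (var ''k'')) \<tau> \<longleftrightarrow> j < ?k"
    if "sum_inv j \<tau>" for j \<tau>
    using that by (simp add: sum_inv_def loaded_scalars)
  obtain k4 \<sigma>4 where e4: "exec (While (NLess (var ''i'') (var ''k'')) sum_body) \<sigma>3 k4 \<sigma>4"
    and \<sigma>4: "sum_inv ?k \<sigma>4"
    and k4: "k4 \<le> 100 * Suc ?k"
    by (rule exec_counting_loop[OF loop_free_bodies(2) test_sum sum_step inv3 iteration_costs(2)])
  obtain k5 where e5: "exec init_walk \<sigma>4 k5 (run init_walk \<sigma>4)"
    and k5: "k5 \<le> max_cost init_walk"
    using exec_loop_free[OF loop_free_init_walk] by blast
  have test: "bval (NLess (var ''i'') (var ''k'')) \<tau> \<longleftrightarrow> j < ?k"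
    if "walk_inv u c j \<tau>" for j \<tau>
    using that unfolding walk_inv_def[OF walk start nonempty] sum_inv_def
    by (simp add: loaded_scalars input_mem_nset)
  obtain k6 \<sigma>6 where
    e6: "exec (While (NLess (var ''i'') (var ''k'')) walk_body) (run init_walk \<sigma>4) k6 \<sigma>6"
    and \<sigma>6: "walk_inv u c ?k \<sigma>6"
    and k6: "k6 \<le> 100 * Suc ?k"
    by (rule exec_counting_loop[OF loop_free_bodies(3) test walk_step[OF walk start nonempty]
            walk_start[OF walk start nonempty \<sigma>4] iteration_costs(3)])
  show thesis
  proof (rule that)
    show "exec find_non_loose \<sigma> (1 + 3 + (1 + k2 + (1 + 3 + (1 + k4 + (1 + k5 + k6))))) \<sigma>6"
      unfolding find_non_loose_def
      by (rule exec_Seq[OF e1 exec_Seq[OF e2 exec_Seq[OF e3 exec_Seq[OF e4 exec_Seq[OF e5 e6]]]]])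
    show "1 + 3 + (1 + k2 + (1 + 3 + (1 + k4 + (1 + k5 + k6)))) \<le> 1000 + 1000 * card (verts G)"
    proof -
      have n: "?n = card (verts G)" using vs by (metis distinct_card)
      have "k5 \<le> 100"
        using k5 init_walk_cost by linarith
      moreover have "k2 \<le> 100 + 100 * card (verts G)" using k2 n by simp
      ultimately show ?thesis using k4 k6 cycle_length_le by simp
    qed
    show "\<exists>e\<in>arcs H. numbers es (nats \<sigma>6 ''out'' 0) e \<and> non_loose G w s t e"
      using walk_end[OF walk start nonempty \<sigma>6] .
  qed
qed

end

text \<open>Existence is stated without numberings or memory, so the minimum residual is taken
  directly over the finite walk, from an arbitrary starting arc.\<close>

lemma (in st_network) slack_cycle_non_loose:
  assumes f: "max_flow G w s t f" and H: "slack_cycle G w f H"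
  shows "\<exists>e\<in>arcs H. non_loose G w s t e"
proof -
  let ?k = "card (arcs H)"
  have cycle: "underlying_cycle H" using H by (simp add: slack_cycle_def)
  then obtain e where e: "e \<in> arcs H" by (fastforce simp: underlying_cycle_def)
  then obtain u c where walk: "cyclic_walk H ?k u c"
    using underlying_cycle_walk[OF cycle e] by blast
  then have arcsH: "arcs H = c ` {..<?k}" by (auto simp: cyclic_walk_def bij_betw_def)
  let ?R = "residual G w f u c ` {..<?k}"
  have "?R \<noteq> {}" using arcsH e by auto
  then have "Min ?R \<in> ?R" by (intro Min_in) auto
  then obtain i where i: "i < ?k" "residual G w f u c i = Min ?R" by auto
  have "non_loose G w s t (c i)"
    using i by (intro min_residual_non_loose[OF f H walk]) auto
  then show ?thesis using arcsH i by auto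
qed

theorem theorem17:
  shows "(\<forall>(G :: ('v, 'e) pre_digraph) w s t f H.
            st_network G w s t \<and> max_flow G w s t f \<and> slack_cycle G w f H \<longrightarrow>
            (\<exists>e \<in> arcs H. non_loose G w s t e)) \<and>
         (\<exists>P T. (\<lambda>n. real (T n)) \<in> O(\<lambda>n. real n) \<and>
            (\<forall>(G :: ('v, 'e) pre_digraph) w s t f H vs es hs \<sigma>.
               st_network G w s t \<and> max_flow G w s t f \<and> slack_cycle G w f H \<and>
               input_mem G w s t f H vs es hs \<sigma> \<longrightarrow>
               (\<exists>k \<sigma>'. exec P \<sigma> k \<sigma>' \<and> k \<le> T (card (verts G)) \<and>
                  (\<exists>e \<in> arcs H. numbers es (nats \<sigma>' ''out'' 0) e \<and> non_loose G w s t e))))"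
proof (intro conjI exI[of _ find_non_loose] exI[of _ "\<lambda>n. 1000 + 1000 * n"] allI impI)
  fix G :: "('v, 'e) pre_digraph" and w s t f H
  assume "st_network G w s t \<and> max_flow G w s t f \<and> slack_cycle G w f H"
  then show "\<exists>e \<in> arcs H. non_loose G w s t e"
    by (elim conjE) (rule st_network.slack_cycle_non_loose)
next
  show "(\<lambda>n. real (1000 + 1000 * n)) \<in> O(\<lambda>n. real n)"
    \<comment> \<open>For \<open>n \<ge> 1\<close> the constant term 1000 is at most
      \<open>1000 * n\<close>.\<close>
    by (rule bigoI[of _ 2000], rule eventually_mono[OF eventually_ge_at_top[of 1]]) simp
next
  fix G :: "('v, 'e) pre_digraph" and w s t f H vs es hs \<sigma>
  assume asm: "st_network G w s t \<and> max_flow G w s t f \<and> slack_cycle G w f H \<and>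
    input_mem G w s t f H vs es hs \<sigma>"
  interpret cycle_input G w s t f H vs es hs
    using asm by (simp only: cycle_input_def cycle_input_axioms_def input_mem_def)
  have "input_mem G w s t f H vs es hs \<sigma>" using asm by simp
  then obtain k \<sigma>' where "exec find_non_loose \<sigma> k \<sigma>'" "k \<le> 1000 + 1000 * card (verts G)"
    "\<exists>e \<in> arcs H. numbers es (nats \<sigma>' ''out'' 0) e \<and> non_loose G w s t e"
    by (rule find_non_loose_correct)
  then show "\<exists>k \<sigma>'. exec find_non_loose \<sigma> k \<sigma>' \<and> k \<le> 1000 + 1000 * card (verts G) \<and>
      (\<exists>e \<in> arcs H. numbers es (nats \<sigma>' ''out'' 0) e \<and> non_loose G w s t e)"
    by (intro exI conjI)
qed

end
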